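(* Let $A$ be a finite-dimensional unital associative algebra over a field $F$. Let $a$ be a ${}_\circ{}^\circ$-nonsingular $n\times n$ matrix of linear mappings of $A$ and $b=(b^1,\dots,b^n)^T\in A^n$. The solution $x=(x^1,\dots,x^n)^T\in A^n$ of the nonsingular system of linear equations $$a\,{}_\circ{}^\circ\,x=b$$ is determined uniquely and can be presented in either of the forms $$x=a^{-1}\,{}_\circ{}^\circ\,b,\qquad x=\mathcal H\det(a,{}_\circ{}^\circ)\,{}_\circ{}^\circ\,b.$$
   Context: A linear mapping of $A$ is a mapping $A\to A$ of the form $x\mapsto\sum_s a_s x b_s$ (finite sum, $a_s,b_s\in A$). A functional matrix is a matrix whose entries $f^i_j$ ($i$ row, $j$ column) are mappings $A\to A$; it is a matrix of linear mappings if all entries are linear mappings of $A$. The ${}_\circ{}^\circ$-product of functional matrices is $(f\,{}_\circ{}^\circ\, g)^i_j=\sum_k f^i_k\circ g^k_j$, with $\circ$ composition, and for a column $x$ over $A$, $(f\,{}_\circ{}^\circ\, x)^i=\sum_k f^i_k(x^k)$. Thus with $a^i_k$ given by $\sum_{p,q} a^{i}_{k}{}^{\cdot pq}\,\overline e_p\otimes\overline e_q$ in a basis $(\overline e_p)$ of $A$ (coefficients in $F$, where $(c\otimes d)\circ x=cxd$), the system reads $\sum_{k,p,q}a^{i}_{k}{}^{\cdot pq}\,\overline e_p x^k\overline e_q=b^i$, $i=1,\dots,n$. $\delta$ is the identity matrix (identity mapping on the diagonal, zero mapping elsewhere). An $n\times n$ matrix $a$ of linear mappings is ${}_\circ{}^\circ$-nonsingular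 if it has a ${}_\circ{}^\circ$-inverse matrix $a^{-1}$, that is, $a\,{}_\circ{}^\circ\, a^{-1}=\delta$; the system $a\,{}_\circ{}^\circ\,x=b$ is then called nonsingular. The Hadamard inverse $\mathcal H m$ of a matrix $m$ is formally the matrix of inverses of the entries of $m$ with rows and columns exchanged, $(\mathcal H m)^j_i=(m^i_j)^{-1}$. The quasideterminant $\det(a,{}_\circ{}^\circ)$ is the matrix whose entries are the formal expressions $\det(a,{}_\circ{}^\circ)^i_j=(\mathcal H a^{-1})^i_j$. *)

theory Defs
  imports "HOL-Analysis.Finite_Cartesian_Product"
begin

text \<open>The sort \<open>{ring, monoid_mult}\<close> is that of unital associative rings; unlike
  \<open>ring_1\<close> it does not exclude the zero ring.\<close>

locale finite_dimensional_algebra = finite_dimensional_vector_space scale B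
  for scale :: "'f::field \<Rightarrow> 'a::{ring, monoid_mult} \<Rightarrow> 'a"
    and B :: "'a set" +
  assumes scale_mult_left: "scale c x * y = scale c (x * y)"
    and scale_mult_right: "x * scale c y = scale c (x * y)"

definition linear_mapping :: "('a::{ring, monoid_mult} \<Rightarrow> 'a) \<Rightarrow> bool" where
  "linear_mapping f \<longleftrightarrow>
     (\<exists>(m::nat) u v. f = (\<lambda>x. \<Sum>s<m. u s * x * v s))"

text \<open>The entry with row index \<open>i\<close> and column index \<open>j\<close> is \<open>f $ i $ j\<close>.\<close>

type_synonym ('a, 'n) fmatrix = "(('a \<Rightarrow> 'a)^'n)^'n"

definition linear_fmatrix :: "('a::{ring, monoid_mult}, 'n::finite) fmatrix \<Rightarrow> bool" where
  "linear_fmatrix f \<longleftrightarrow> (\<forall>i j. linear_mapping (f $ i $ j))"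

definition fmat_mult ::
  "('a::ring, 'n::finite) fmatrix \<Rightarrow> ('a, 'n) fmatrix \<Rightarrow> ('a, 'n) fmatrix"
  (infixl "\<circ>\<^sub>m" 70) where
  "f \<circ>\<^sub>m g = (\<chi> i j. (\<lambda>y. \<Sum>k\<in>UNIV. (f $ i $ k \<circ> g $ k $ j) y))"

definition fmat_app :: "('a::ring, 'n::finite) fmatrix \<Rightarrow> 'a^'n \<Rightarrow> 'a^'n"
  (infixr "\<circ>\<^sub>v" 70) where
  "f \<circ>\<^sub>v x = (\<chi> i. \<Sum>k\<in>UNIV. (f $ i $ k) (x $ k))"

definition fmat_id :: "('a::ring, 'n::finite) fmatrix" where
  "fmat_id = (\<chi> i j. if i = j then id else (\<lambda>_. 0))"

definition fmat_nonsingular :: "('a::ring, 'n::finite) fmatrix \<Rightarrow> bool" where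
  "fmat_nonsingular a \<longleftrightarrow> (\<exists>a'. a \<circ>\<^sub>m a' = fmat_id)"

text \<open>Meaningful for nonsingular matrices only.  As in the definition of nonsingularity, the
  inverse is a right inverse and its entries are not required to be linear mappings.\<close>

definition fmat_inv :: "('a::ring, 'n::finite) fmatrix \<Rightarrow> ('a, 'n) fmatrix" where
  "fmat_inv a = (SOME a'. a \<circ>\<^sub>m a' = fmat_id)"

text \<open>The entries of a Hadamard inverse are formal expressions: an entry of a nonsingular matrix,
  or of its inverse, need not be an invertible mapping (the off-diagonal entries of the identity
  matrix are zero).\<close>

datatype 'a fexpr = Mapping "'a \<Rightarrow> 'a" | Inverse "'a fexpr"

text \<open>The mapping denoted by a formal expression, if there is one.  A double inverse
  cancels formally; a single inverse of a mapping denotes something only if the mapping is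
  bijective.\<close>

fun fexpr_value :: "'a fexpr \<Rightarrow> ('a \<Rightarrow> 'a) option" where
  "fexpr_value (Mapping f) = Some f"
| "fexpr_value (Inverse (Mapping f)) = (if bij f then Some (inv f) else None)"
| "fexpr_value (Inverse (Inverse e)) = fexpr_value e"

definition formal_matrix :: "('a, 'n::finite) fmatrix \<Rightarrow> ('a fexpr^'n)^'n" where
  "formal_matrix f = (\<chi> i j. Mapping (f $ i $ j))"

definition denotes :: "('a fexpr^'n)^'n \<Rightarrow> ('a, 'n::finite) fmatrix \<Rightarrow> bool" where
  "denotes E f \<longleftrightarrow> (\<forall>i j. fexpr_value (E $ i $ j) = Some (f $ i $ j))"

definition hadamard_inverse :: "('a fexpr^'n)^'n \<Rightarrow> ('a fexpr^'n::finite)^'n" where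
  "hadamard_inverse E = (\<chi> j i. Inverse (E $ i $ j))"

definition quasidet :: "('a::ring, 'n::finite) fmatrix \<Rightarrow> ('a fexpr^'n)^'n" where
  "quasidet a = hadamard_inverse (formal_matrix (fmat_inv a))"

end

theory Submission
  imports Defs
begin

text \<open>
  The map \<open>x \<mapsto> a \<circ>\<^sub>v x\<close> on the space of columns is linear over the ground field, because
  every mapping \<open>x \<mapsto> \<Sum>s. u s * x * v s\<close> is.  Any right inverse \<open>a'\<close> of \<open>a\<close> makes
  this map surjective: the entries of \<open>a\<close> are additive and so pass through the sums in
  \<open>a' \<circ>\<^sub>v b\<close>, whence \<open>a \<circ>\<^sub>v (a' \<circ>\<^sub>v b) = (a \<circ>\<^sub>m a') \<circ>\<^sub>v b = b\<close>
  (\<open>fmat_app_mult\<close>).  The columns form a finite-dimensional space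
  (\<open>finite_dimensional_columns\<close>), on which a surjective linear map is injective; hence the
  solution is unique and equals \<open>fmat_inv a \<circ>\<^sub>v b\<close>.

  The second form of the solution is the first one in disguise.  The quasideterminant is
  itself a Hadamard inverse, and a double Hadamard inverse transposes twice and inverts every
  entry formally twice, so it denotes the original matrix even where single entries are not
  invertible (\<open>denotes_hadamard_quasidet\<close>).
\<close>

lemma linear_mapping_add:
  assumes "linear_mapping f"
  shows "f (x + y) = f x + f y"
  using assms by (auto simp: linear_mapping_def distrib_left distrib_right sum.distrib)

lemma linear_mapping_sum:
  assumes "linear_mapping f"
  shows "f (\<Sum>j\<in>J. g j) = (\<Sum>j\<in>J. f (g j))"
proof -
  have zero: "f 0 = 0"
    using linear_mapping_add[OF assms, of 0 0] by simp
  show ?thesis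
    by (induction J rule: infinite_finite_induct)
      (simp_all add: zero linear_mapping_add[OF assms])
qed

lemma (in finite_dimensional_algebra) linear_mapping_scale:
  assumes "linear_mapping f"
  shows "f (scale c x) = scale c (f x)"
  using assms
  by (auto simp: linear_mapping_def scale_mult_left scale_mult_right scale_sum_right)

text \<open>The additive entries of the left factor pass through the inner sum.  The right factor
  is arbitrary because the lemma is applied to an inverse matrix, about whose entries nothing
  is known.\<close>

lemma fmat_app_mult:
  assumes "linear_fmatrix f"
  shows "f \<circ>\<^sub>v (g \<circ>\<^sub>v x) = (f \<circ>\<^sub>m g) \<circ>\<^sub>v x"
proof -
  have lin: "linear_mapping (f $ i $ k)" for i k
    using assms by (simp add: linear_fmatrix_def)
  have "(\<Sum>k\<in>UNIV. \<Sum>j\<in>UNIV. (f $ i $ k) ((g $ k $ j) (x $ j))) =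
      (\<Sum>j\<in>UNIV. \<Sum>k\<in>UNIV. (f $ i $ k) ((g $ k $ j) (x $ j)))" for i
    by (rule sum.swap)
  then show ?thesis
    by (simp add: vec_eq_iff fmat_app_def fmat_mult_def linear_mapping_sum[OF lin])
qed

lemma fmat_app_id: "fmat_id \<circ>\<^sub>v x = x"
proof -
  have "(if i = k then id else (\<lambda>_. 0)) (x $ k) = (if i = k then x $ k else 0)" for i k
    by simp
  then show ?thesis
    by (simp add: vec_eq_iff fmat_app_def fmat_id_def)
qed

lemma fmat_inv_right:
  assumes "fmat_nonsingular a"
  shows "a \<circ>\<^sub>m fmat_inv a = fmat_id"
  using assms unfolding fmat_nonsingular_def fmat_inv_def by (rule someI_ex)

text \<open>Extracting a basis from a finite spanning set avoids proving independence of the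
  concrete set of generators.\<close>

lemma (in vector_space) finite_dimensional_if_finite_span:
  assumes "finite S" and "span S = UNIV"
  shows "\<exists>C. finite_dimensional_vector_space scale C"
proof -
  obtain C where C: "C \<subseteq> S" "independent C" "S \<subseteq> span C"
    using maximal_independent_subset[of S] by blast
  have "span S \<subseteq> span C"
    using C(3) by (simp add: span_minimal)
  then have "span C = UNIV"
    using assms(2) by blast
  moreover have "finite C"
    using C(1) assms(1) by (rule finite_subset)
  ultimately have "finite_dimensional_vector_space scale C"
    using C(2) by unfold_locales auto
  then show ?thesis by blast
qed

definition column_scale :: "('f \<Rightarrow> 'a \<Rightarrow> 'a) \<Rightarrow> 'f \<Rightarrow> 'a^'n \<Rightarrow> 'a^'n" where
  "column_scale s c x = (\<chi> i. s c (x $ i))"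

text \<open>A column is the sum of its one-entry columns, and a one-entry column depends linearly on
  its entry.  Hence the columns with a single basis vector as entry span the whole space.\<close>

lemma (in finite_dimensional_vector_space) finite_dimensional_columns:
  "\<exists>C :: ('b^'n::finite) set. finite_dimensional_vector_space (column_scale scale) C"
proof -
  interpret col: vector_space "column_scale scale :: 'a \<Rightarrow> 'b^'n \<Rightarrow> 'b^'n"
    by unfold_locales
      (simp_all add: column_scale_def vec_eq_iff scale_right_distrib scale_left_distrib)
  define S :: "('b^'n) set" where "S = (\<Union>i. axis i ` Basis)"
  have axis_in: "axis i y \<in> col.span S" for i y
  proof -
    have "y \<in> span Basis"
      by (simp add: span_Basis)
    then show ?thesis
    proof (induction rule: span_induct_alt)
      case base
      have "axis i 0 = (0 :: 'b^'n)"
        by (simp add: vec_eq_iff axis_def)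
      then show ?case
        using col.span_zero by metis
    next
      case (step c v w)
      have "axis i (scale c v + w) = column_scale scale c (axis i v) + axis i w"
        by (simp add: vec_eq_iff axis_def column_scale_def)
      moreover have "axis i v \<in> S"
        using step by (auto simp: S_def)
      ultimately show ?case
        using step by (simp add: col.span_add col.span_scale col.span_base)
    qed
  qed
  have "x = (\<Sum>i\<in>UNIV. axis i (x $ i))" for x :: "'b^'n"
    by (simp add: vec_eq_iff axis_def)
  then have "col.span S = UNIV"
    using axis_in by (metis UNIV_eq_I col.span_sum)
  moreover have "finite S"
    by (simp add: S_def finite_Basis)
  ultimately show ?thesis
    by (rule col.finite_dimensional_if_finite_span[rotated])
qed

text \<open>A right inverse gives surjectivity, and finite dimension turns it into injectivity.\<close>

lemma (in finite_dimensional_algebra) fmat_app_inj_if_nonsingular: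
  fixes a :: "('a, 'n::finite) fmatrix"
  assumes "linear_fmatrix a" and "fmat_nonsingular a"
  shows "inj (\<lambda>x. a \<circ>\<^sub>v x)"
proof -
  obtain C :: "('a^'n) set"
    where "finite_dimensional_vector_space (column_scale scale) C"
    using finite_dimensional_columns by blast
  then interpret col: finite_dimensional_vector_space "column_scale scale" C .
  have entry: "linear_mapping (a $ i $ k)" for i k
    using assms(1) by (simp add: linear_fmatrix_def)
  have "Vector_Spaces.linear (column_scale scale) (column_scale scale) (\<lambda>x. a \<circ>\<^sub>v x)"
    by unfold_locales
      (simp_all add: vec_eq_iff fmat_app_def column_scale_def linear_mapping_add[OF entry]
        linear_mapping_scale[OF entry] sum.distrib scale_sum_right)
  moreover have "surj (\<lambda>x. a \<circ>\<^sub>v x)"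
    by (rule surjI[where f = "\<lambda>x. fmat_inv a \<circ>\<^sub>v x"])
      (simp add: fmat_app_mult[OF assms(1)] fmat_inv_right[OF assms(2)] fmat_app_id)
  ultimately show ?thesis
    by (rule col.linear_surj_imp_inj)
qed

lemma denotes_hadamard_quasidet: "denotes (hadamard_inverse (quasidet a)) (fmat_inv a)"
  by (simp add: denotes_def hadamard_inverse_def quasidet_def formal_matrix_def)

theorem theorem8p5:
  fixes scale :: "'f::field \<Rightarrow> 'a::{ring, monoid_mult} \<Rightarrow> 'a"
    and B :: "'a set"
    and a :: "('a, 'n::finite) fmatrix"
    and b :: "'a^'n"
  assumes "finite_dimensional_algebra scale B"
    and "linear_fmatrix a"
    and "fmat_nonsingular a"
  shows "(\<exists>!x. a \<circ>\<^sub>v x = b) \<and>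
    (\<forall>x. a \<circ>\<^sub>v x = b \<longrightarrow>
      x = fmat_inv a \<circ>\<^sub>v b \<and>
      (\<exists>h. denotes (hadamard_inverse (quasidet a)) h \<and> x = h \<circ>\<^sub>v b))"
proof -
  interpret finite_dimensional_algebra scale B
    by (rule assms(1))
  have solution: "a \<circ>\<^sub>v (fmat_inv a \<circ>\<^sub>v b) = b"
    by (simp add: fmat_app_mult[OF assms(2)] fmat_inv_right[OF assms(3)] fmat_app_id)
  have unique: "x = fmat_inv a \<circ>\<^sub>v b" if "a \<circ>\<^sub>v x = b" for x
    using fmat_app_inj_if_nonsingular[OF assms(2,3)] that solution by (simp add: inj_def)
  show ?thesis
    using solution unique denotes_hadamard_quasidet[of a] by blast
qed

end
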